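(* Let $p$ be an odd prime, $\alpha,\beta\in\mathbb Z_p$ and $\gamma\in\mathbb Z_p^\times$ with $\langle-\alpha\rangle_p\le\langle-\gamma\rangle_p$ and $\langle-\beta\rangle_p\leq\langle-\gamma\rangle_p$. (i) If $\langle-\alpha\rangle_p+\langle-\beta\rangle_p\leq\langle-\gamma\rangle_p$, then $$ {}_2F_1\bigg[\begin{matrix}\alpha&\beta\\&\gamma\end{matrix}\bigg|\,1\bigg]_{\langle-\gamma\rangle_p}\equiv\frac{\Gamma_p(\gamma)\Gamma_p(\gamma-\alpha-\beta)}{\Gamma_p(\gamma-\alpha)\Gamma_p(\gamma-\beta)}\pmod{p^2}. $$ (ii) If $\langle-\alpha\rangle_p+\langle-\beta\rangle_p>\langle-\gamma\rangle_p$, then $$ {}_2F_1\bigg[\begin{matrix}\alpha&\beta\\&\gamma\end{matrix}\bigg|\,1\bigg]_{\langle-\gamma\rangle_p}\equiv (\gamma+\langle-\gamma\rangle_p-\alpha-\langle-\alpha\rangle_p-\beta-\langle-\beta\rangle_p)\cdot \frac{\Gamma_p(\gamma)\Gamma_p(\gamma-\alpha-\beta)}{\Gamma_p(\gamma-\alpha)\Gamma_p(\gamma-\beta)}\pmod{p^2}. $$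
   Context: $\mathbb Z_p$ denotes the $p$-adic integers and $\mathbb Z_p^\times$ its units. For $\alpha\in\mathbb Z_p$, $\langle\alpha\rangle_p$ is the unique integer in $\{0,1,\ldots,p-1\}$ congruent to $\alpha$ modulo $p$. Pochhammer symbol: $(x)_0=1$, $(x)_k=x(x+1)\cdots(x+k-1)$. For $n\ge 0$, ${}_{2}F_1\Big[\begin{matrix}\alpha&\beta\\&\gamma\end{matrix}\Big|\,z\Big]_n=\sum_{k=0}^{n}\frac{(\alpha)_k(\beta)_k}{(\gamma)_k}\cdot\frac{z^k}{k!}$. $\Gamma_p$ is Morita's $p$-adic gamma function: $\Gamma_p(n)=(-1)^n\prod_{1\le j<n,\ p\nmid j}j$ for integers $n\ge1$, $\Gamma_p(0)=1$, extended to $\mathbb Z_p$ by continuity. For $x,y\in\mathbb Q_p$, $x\equiv y\pmod{p^2}$ means $x-y\in p^2\mathbb Z_p$. *)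

theory Defs
  imports
    "HOL-Analysis.Analysis"
    "HOL-Computational_Algebra.Computational_Algebra"
    "Berlekamp_Zassenhaus.Finite_Field"
begin

section \<open>The ring of p-adic integers\<close>

text \<open>
  The prime is carried by a type: for \<open>'p :: prime_card\<close> it is \<open>CARD('p)\<close>.
  A p-adic integer is a coherent sequence of residues, i.e. an element of the inverse
  limit of the rings Z/p^n, with each residue given by its representative in [0, p^n).
\<close>

typedef (overloaded) ('p :: prime_card) padic_int =
  "{x :: nat \<Rightarrow> int. \<forall>n. 0 \<le> x n \<and> x n < int CARD('p) ^ n \<and>
      x (Suc n) mod int CARD('p) ^ n = x n}"
  morphisms padic_res Abs_padic_int
  by (rule exI[of _ "\<lambda>_. 0"]) (auto simp: prime_gt_0_nat[OF prime_card])

setup_lifting type_definition_padic_int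

lemma prime_card_power_pos: "int CARD('p :: prime_card) ^ n > 0"
  by (simp add: prime_gt_0_nat[OF prime_card])

lemma mod_prime_card_power_Suc:
  "(a mod int CARD('p :: prime_card) ^ Suc n) mod int CARD('p) ^ n = a mod int CARD('p) ^ n"
  by (rule mod_mod_cancel) simp

instantiation padic_int :: (prime_card) comm_ring_1
begin

lift_definition zero_padic_int :: "'a padic_int" is "\<lambda>_. 0"
  by (auto simp: prime_card_power_pos)

lift_definition one_padic_int :: "'a padic_int" is "\<lambda>n. 1 mod int CARD('a) ^ n"
  by (auto simp: prime_card_power_pos mod_prime_card_power_Suc simp del: power_Suc)

lift_definition plus_padic_int :: "'a padic_int \<Rightarrow> 'a padic_int \<Rightarrow> 'a padic_int"
  is "\<lambda>x y n. (x n + y n) mod int CARD('a) ^ n"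
  by (simp add: prime_card_power_pos mod_prime_card_power_Suc del: power_Suc)
     (metis mod_add_eq)

lift_definition minus_padic_int :: "'a padic_int \<Rightarrow> 'a padic_int \<Rightarrow> 'a padic_int"
  is "\<lambda>x y n. (x n - y n) mod int CARD('a) ^ n"
  by (simp add: prime_card_power_pos mod_prime_card_power_Suc del: power_Suc)
     (metis mod_diff_eq)

lift_definition uminus_padic_int :: "'a padic_int \<Rightarrow> 'a padic_int"
  is "\<lambda>x n. (- x n) mod int CARD('a) ^ n"
  by (simp add: prime_card_power_pos mod_prime_card_power_Suc del: power_Suc)
     (metis mod_minus_eq)

lift_definition times_padic_int :: "'a padic_int \<Rightarrow> 'a padic_int \<Rightarrow> 'a padic_int"
  is "\<lambda>x y n. (x n * y n) mod int CARD('a) ^ n"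
  by (simp add: prime_card_power_pos mod_prime_card_power_Suc del: power_Suc)
     (metis mod_mult_eq)

instance
proof
  fix a b c :: "'a padic_int"
  show "a + b + c = a + (b + c)"
    by transfer (simp add: mod_simps add.assoc)
  show "a + b = b + a"
    by transfer (simp add: add.commute)
  show "0 + a = a"
    by transfer (auto simp: fun_eq_iff)
  show "- a + a = 0"
    by transfer (auto simp: fun_eq_iff mod_simps)
  show "a - b = a + - b"
    by transfer (auto simp: fun_eq_iff mod_simps)
  show "a * b * c = a * (b * c)"
    by transfer (auto simp: fun_eq_iff mod_simps mult.assoc)
  show "a * b = b * a"
    by transfer (simp add: mult.commute)
  show "1 * a = a"
    by transfer (auto simp: fun_eq_iff mod_simps)
  show "(a + b) * c = a * c + b * c"
    by transfer (auto simp: fun_eq_iff mod_simps distrib_right)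
  have "(1 :: int) mod int CARD('a) ^ Suc 0 \<noteq> 0"
    using prime_gt_1_nat[OF prime_card[where 'a = 'a]] by simp
  then show "(0 :: 'a padic_int) \<noteq> 1"
    by transfer metis
qed

end

lemma padic_res_range:
  "0 \<le> padic_res (x :: 'p :: prime_card padic_int) n" "padic_res x n < int CARD('p) ^ n"
  using padic_res[of x] by auto

lemma padic_res_mod:
  assumes "m \<le> n"
  shows "padic_res (x :: 'p :: prime_card padic_int) n mod int CARD('p) ^ m = padic_res x m"
  using assms
proof (induction n rule: dec_induct)
  case base
  show ?case by (simp add: padic_res_range)
next
  case (step n)
  have "padic_res x (Suc n) mod int CARD('p) ^ n = padic_res x n"
    using padic_res[of x] by auto
  moreover have "int CARD('p) ^ m dvd int CARD('p) ^ n"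
    using step by (intro le_imp_power_dvd) simp
  ultimately show ?case
    using step by (metis mod_mod_cancel)
qed

lemma padic_res_of_nat:
  "padic_res (of_nat k :: 'p :: prime_card padic_int) n = int k mod int CARD('p) ^ n"
  by (induction k) (simp_all add: zero_padic_int.rep_eq plus_padic_int.rep_eq
      one_padic_int.rep_eq mod_simps)

lemma padic_res_eqI: "(\<And>n. padic_res x n = padic_res y n) \<Longrightarrow> x = y"
  by (simp add: padic_res_inject fun_eq_iff flip: padic_res_inject)

instance padic_int :: (prime_card) idom
proof
  fix a b :: "'a padic_int"
  assume "a \<noteq> 0" "b \<noteq> 0"
  let ?p = "int CARD('a)"
  from \<open>a \<noteq> 0\<close> obtain m where m: "padic_res a m \<noteq> 0"
    by (metis padic_res_eqI zero_padic_int.rep_eq)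
  from \<open>b \<noteq> 0\<close> obtain n where n: "padic_res b n \<noteq> 0"
    by (metis padic_res_eqI zero_padic_int.rep_eq)
  let ?a = "padic_res a (m + n)" and ?b = "padic_res b (m + n)"
  have a: "\<not> ?p ^ m dvd ?a"
    using padic_res_mod[of m "m + n" a] m by (simp add: dvd_eq_mod_eq_0)
  have b: "\<not> ?p ^ n dvd ?b"
    using padic_res_mod[of n "m + n" b] n by (simp add: dvd_eq_mod_eq_0)
  have pr: "prime_elem ?p"
    using prime_card[where 'a = 'a] by simp
  have ab0: "?a \<noteq> 0" "?b \<noteq> 0"
    using a b by auto
  have nu: "\<not> is_unit ?p"
    using pr by (rule prime_elem_not_unit)
  have "multiplicity ?p ?a < m" "multiplicity ?p ?b < n"
    using a b ab0 nu by (metis multiplicity_dvd' not_less)+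
  then have "multiplicity ?p (?a * ?b) < m + n"
    using pr ab0 by (simp add: prime_elem_multiplicity_mult_distrib)
  then have "\<not> ?p ^ (m + n) dvd ?a * ?b"
    using ab0 nu by (metis multiplicity_geI mult_eq_0_iff not_less)
  then have "padic_res (a * b) (m + n) \<noteq> 0"
    by (simp add: times_padic_int.rep_eq dvd_eq_mod_eq_0)
  then show "a * b \<noteq> 0"
    by (metis zero_padic_int.rep_eq)
qed

instance padic_int :: (prime_card) ring_char_0
proof (standard, rule injI)
  fix j k :: nat
  assume eq: "(of_nat j :: 'a padic_int) = of_nat k"
  have p: "CARD('a) > 1"
    by (rule prime_gt_1_nat[OF prime_card])
  define n where "n = max j k"
  have "n < CARD('a) ^ n"
    using p by (simp add: power_gt_expt)
  then have "j < CARD('a) ^ n" "k < CARD('a) ^ n"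
    by (auto simp: n_def)
  moreover have "int j mod int CARD('a) ^ n = int k mod int CARD('a) ^ n"
    using arg_cong[OF eq, of "\<lambda>x. padic_res x n"] by (simp only: padic_res_of_nat)
  ultimately show "j = k"
    by (metis mod_less of_nat_eq_iff of_nat_power zmod_int)
qed

lemma padic_power_dvd_iff:
  "of_nat CARD('p) ^ n dvd (x :: 'p :: prime_card padic_int) \<longleftrightarrow> padic_res x n = 0"
proof
  assume "of_nat CARD('p) ^ n dvd x"
  then obtain y where "x = of_nat (CARD('p) ^ n) * y"
    by (auto simp: of_nat_power)
  then have "padic_res x n = (int (CARD('p) ^ n) mod int CARD('p) ^ n * padic_res y n)
      mod int CARD('p) ^ n"
    by (simp only: times_padic_int.rep_eq padic_res_of_nat)
  also have "int (CARD('p) ^ n) mod int CARD('p) ^ n = 0"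
    by simp
  finally show "padic_res x n = 0"
    by simp
next
  let ?p = "int CARD('p)"
  assume 0: "padic_res x n = 0"
  define y where "y m = padic_res x (m + n) div ?p ^ n" for m
  have dvd: "?p ^ n dvd padic_res x (m + n)" for m
    using padic_res_mod[of n "m + n" x] 0 by (simp add: dvd_eq_mod_eq_0)
  have y: "padic_res x (m + n) = ?p ^ n * y m" for m
    using dvd[of m] by (simp add: y_def)
  have pos: "?p ^ n > 0"
    by (rule prime_card_power_pos)
  have "0 \<le> y m \<and> y m < ?p ^ m \<and> y (Suc m) mod ?p ^ m = y m" for m
  proof (intro conjI)
    show "0 \<le> y m"
      by (simp add: y_def padic_res_range pos_imp_zdiv_nonneg_iff pos)
    have "?p ^ n * y m < ?p ^ n * ?p ^ m"
      using padic_res_range(2)[of x "m + n"] by (simp add: y power_add mult.commute)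
    then show "y m < ?p ^ m"
      using pos by (simp only: mult_less_cancel_left_pos)
    have "?p ^ n * y (Suc m) mod (?p ^ n * ?p ^ m) = ?p ^ n * y m"
      using padic_res_mod[of "m + n" "Suc m + n" x] y[of "Suc m"] y[of m]
      by (simp add: power_add mult.commute)
    then have "?p ^ n * (y (Suc m) mod ?p ^ m) = ?p ^ n * y m"
      by (simp only: mod_mult_mult1)
    then show "y (Suc m) mod ?p ^ m = y m"
      using pos by simp
  qed
  then have rep: "padic_res (Abs_padic_int y :: 'p padic_int) = y"
    by (intro Abs_padic_int_inverse) simp
  have "x = of_nat (CARD('p) ^ n) * Abs_padic_int y"
  proof (rule padic_res_eqI)
    fix m
    have "padic_res (of_nat (CARD('p) ^ n) * Abs_padic_int y :: 'p padic_int) m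
        = (?p ^ n * y m) mod ?p ^ m"
      unfolding times_padic_int.rep_eq padic_res_of_nat rep by (simp add: mod_simps)
    also have "\<dots> = padic_res x m"
      using padic_res_mod[of m "m + n" x] by (simp add: y)
    finally show "padic_res x m =
        padic_res (of_nat (CARD('p) ^ n) * Abs_padic_int y :: 'p padic_int) m"
      by (rule sym)
  qed
  then show "of_nat CARD('p) ^ n dvd x"
    by (simp add: of_nat_power)
qed


section \<open>The p-adic topology\<close>

definition padic_abs :: "'p :: prime_card padic_int \<Rightarrow> real" where
  "padic_abs x = (if x = 0 then 0
     else 1 / real CARD('p) ^ (GREATEST n. of_nat CARD('p) ^ n dvd x))"

lemma padic_abs_le_iff:
  "padic_abs (x :: 'p :: prime_card padic_int) \<le> 1 / real CARD('p) ^ n \<longleftrightarrow>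
     of_nat CARD('p) ^ n dvd x"
proof (cases "x = 0")
  case True
  then show ?thesis by (simp add: padic_abs_def)
next
  case False
  let ?p = "of_nat CARD('p) :: 'p padic_int"
  have p: "1 < real CARD('p)"
    using prime_gt_1_nat[OF prime_card[where 'a = 'p]] by simp
  obtain N where "padic_res x N \<noteq> 0"
    using False by (metis padic_res_eqI zero_padic_int.rep_eq)
  then have N: "\<not> ?p ^ N dvd x"
    by (simp add: padic_power_dvd_iff)
  have bnd: "k \<le> N" if "?p ^ k dvd x" for k
    using that N by (meson dvd_trans le_imp_power_dvd nat_le_linear)
  let ?g = "GREATEST k. ?p ^ k dvd x"
  have g: "?p ^ ?g dvd x"
    by (rule GreatestI_nat[where k = 0 and b = N]) (use bnd in auto)
  have "padic_abs x \<le> 1 / real CARD('p) ^ n \<longleftrightarrow> n \<le> ?g"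
    using False p by (simp add: padic_abs_def field_simps)
  also have "\<dots> \<longleftrightarrow> ?p ^ n dvd x"
    using g by (auto intro: Greatest_le_nat[where b = N] bnd
        dvd_trans[OF le_imp_power_dvd])
  finally show ?thesis .
qed

lemma padic_abs_cases:
  obtains "x = 0" "padic_abs x = 0"
  | n where "x \<noteq> 0" "padic_abs (x :: 'p :: prime_card padic_int) = 1 / real CARD('p) ^ n"
  by (cases "x = 0") (auto simp: padic_abs_def)

lemma padic_abs_nonneg: "padic_abs x \<ge> 0"
  by (simp add: padic_abs_def)

lemma padic_abs_eq_0_iff: "padic_abs (x :: 'p :: prime_card padic_int) = 0 \<longleftrightarrow> x = 0"
  using prime_gt_0_nat[OF prime_card[where 'a = 'p]] by (simp add: padic_abs_def)

lemma padic_abs_minus: "padic_abs (- x) = padic_abs x"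
  by (simp add: padic_abs_def)

lemma padic_abs_ultrametric:
  "padic_abs (x + y) \<le> max (padic_abs x) (padic_abs (y :: 'p :: prime_card padic_int))"
proof -
  have *: "padic_abs (x + y) \<le> padic_abs x" if "padic_abs y \<le> padic_abs x"
    for x y :: "'p padic_int"
  proof (cases rule: padic_abs_cases[of x])
    case 1
    then have "y = 0"
      using that padic_abs_nonneg[of y] padic_abs_eq_0_iff[of y] by simp
    then show ?thesis by simp
  next
    case (2 n)
    then show ?thesis
      using that by (metis dvd_add order_refl padic_abs_le_iff)
  qed
  show ?thesis
    using *[of x y] *[of y x] by (auto simp: max_def add.commute)
qed

instantiation padic_int :: (prime_card) metric_space
begin

definition dist_padic_int :: "'a padic_int \<Rightarrow> 'a padic_int \<Rightarrow> real" where
  "dist_padic_int x y = padic_abs (x - y)"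

definition uniformity_padic_int :: "('a padic_int \<times> 'a padic_int) filter" where
  "uniformity_padic_int = (INF e\<in>{0<..}. principal {(x, y). dist x y < e})"

definition open_padic_int :: "'a padic_int set \<Rightarrow> bool" where
  "open_padic_int U \<longleftrightarrow> (\<forall>x\<in>U. eventually (\<lambda>(x', y). x' = x \<longrightarrow> y \<in> U) uniformity)"

instance
proof
  fix x y z :: "'a padic_int"
  show "dist x y = 0 \<longleftrightarrow> x = y"
    by (simp add: dist_padic_int_def padic_abs_eq_0_iff)
  have "padic_abs ((x - z) + - (y - z)) \<le> max (padic_abs (x - z)) (padic_abs (- (y - z)))"
    by (rule padic_abs_ultrametric)
  also have "\<dots> \<le> padic_abs (x - z) + padic_abs (y - z)"
    using padic_abs_nonneg[of "x - z"] padic_abs_nonneg[of "y - z"]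
    unfolding padic_abs_minus by simp
  finally show "dist x y \<le> dist x z + dist y z"
    by (simp add: dist_padic_int_def)
qed (simp_all only: uniformity_padic_int_def open_padic_int_def)

end


section \<open>The field of p-adic numbers\<close>

instance fract :: ("{idom, ring_char_0}") ring_char_0
proof (standard, rule injI)
  fix m n :: nat
  have of_nat: "(of_nat k :: 'a fract) = to_fract (of_nat k)" for k
    by (induction k) simp_all
  assume "(of_nat m :: 'a fract) = of_nat n"
  then show "m = n"
    by (simp add: of_nat)
qed

instance fract :: ("{idom, ring_char_0}") field_char_0 ..

type_synonym 'p padic = "'p padic_int fract"

definition padic_cong :: "nat \<Rightarrow> 'p :: prime_card padic \<Rightarrow> 'p padic \<Rightarrow> bool" where
  "padic_cong n x y \<longleftrightarrow> x - y \<in> range (\<lambda>z. of_nat CARD('p) ^ n * to_fract z)"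


section \<open>Least residues, truncated hypergeometric sums, the p-adic Gamma function\<close>

definition padic_residue :: "'p :: prime_card padic_int \<Rightarrow> nat" where
  "padic_residue \<alpha> = (THE r. r < CARD('p) \<and> of_nat CARD('p) dvd (\<alpha> - of_nat r))"

lemma padic_residue_unique:
  "\<exists>!r. r < CARD('p) \<and> of_nat CARD('p) dvd ((\<alpha> :: 'p :: prime_card padic_int) - of_nat r)"
proof -
  have dvd: "of_nat CARD('p) dvd (\<alpha> - of_nat r) \<longleftrightarrow> int r = padic_res \<alpha> 1"
    if "r < CARD('p)" for r
  proof -
    have "of_nat CARD('p) dvd (\<alpha> - of_nat r) \<longleftrightarrow>
        (padic_res \<alpha> 1 - int r) mod int CARD('p) = 0"
      using padic_power_dvd_iff[of 1 "\<alpha> - of_nat r"]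
      by (simp add: minus_padic_int.rep_eq padic_res_of_nat mod_simps)
    also have "\<dots> \<longleftrightarrow> padic_res \<alpha> 1 mod int CARD('p) = int r mod int CARD('p)"
      by (simp add: mod_eq_dvd_iff dvd_eq_mod_eq_0)
    finally show ?thesis
      using padic_res_range[of \<alpha> 1] that by auto
  qed
  show ?thesis
    by (rule ex1I[of _ "nat (padic_res \<alpha> 1)"])
       (use dvd[of "nat (padic_res \<alpha> 1)"] dvd padic_res_range[of \<alpha> 1] in
         \<open>auto simp: nat_less_iff simp del: of_nat_nat\<close>)
qed

definition hyp2F1_trunc :: "'a :: field_char_0 \<Rightarrow> 'a \<Rightarrow> 'a \<Rightarrow> 'a \<Rightarrow> nat \<Rightarrow> 'a" where
  "hyp2F1_trunc \<alpha> \<beta> \<gamma> z n =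
     (\<Sum>k=0..n. pochhammer \<alpha> k * pochhammer \<beta> k / pochhammer \<gamma> k * (z ^ k / fact k))"

text \<open>The formula below gives the value 1 at 0, because the product is then empty.\<close>

definition padic_Gamma :: "'p :: prime_card padic_int \<Rightarrow> 'p padic_int" where
  "padic_Gamma = (THE f. continuous_on UNIV f \<and>
     (\<forall>n. f (of_nat n) = (- 1) ^ n * of_nat (\<Prod>j | 1 \<le> j \<and> j < n \<and> \<not> CARD('p) dvd j. j)))"

end

theory Submission
  imports
    Defs
    "HOL-Number_Theory.Residue_Primitive_Roots"
    "HOL-Number_Theory.Modular_Inverse"
begin

text \<open>
  Write \<open>a, b, c\<close> for the least residues of \<open>-\<alpha>, -\<beta>, -\<gamma>\<close> and \<open>F(\<alpha>, \<beta>)\<close> for the truncated sum.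
  Termwise, \<open>F(\<alpha>, \<beta>) - F(\<alpha>, -b) - F(-a, \<beta>) + F(-a, -b)\<close> is a product of two differences of
  Pochhammer symbols, each divisible by \<open>p\<close>, over a unit; so it vanishes modulo \<open>p\<^sup>2\<close>. The three
  sums with a terminating parameter are evaluated exactly by the Chu-Vandermonde identity, whose
  value is the Gamma quotient \<open>R\<close> at the same arguments, times the one factor divisible by \<open>p\<close>
  in the Pochhammer symbol when \<open>a + b > c\<close>. It remains to see that \<open>R\<close> is constant modulo \<open>p\<close>
  and, in the first case, that its mixed difference also vanishes modulo \<open>p\<^sup>2\<close>. The latter
  comes from \<open>\<Gamma>(y + s + t) \<Gamma>(y) \<equiv> \<Gamma>(y + s) \<Gamma>(y + t)\<close> modulo \<open>p\<^sup>2\<close> for \<open>s, t\<close> divisible by \<open>p\<close>.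
\<close>

section \<open>Morita's products\<close>

text \<open>Wilson's theorem for \<open>p ^ k\<close>: for a primitive root \<open>g\<close> the
  product is \<open>g\<close> to the power \<open>0 + ... + (t - 1)\<close>. With
  \<open>t = 2 * h\<close> this is \<open>(g ^ h) ^ (t - 1)\<close>, where \<open>g ^ h\<close> is
  congruent to \<open>-1\<close> and \<open>t - 1\<close> is odd.\<close>

lemma prod_totatives_odd_prime_power:
  assumes p: "prime p" "odd p" and k: "k > 0"
  shows "[(\<Prod>j\<in>totatives (p ^ k). int j) = -1] (mod int (p ^ k))"
proof -
  obtain g where g: "residue_primroot (p ^ k) g"
    using residue_primroot_odd_prime_power_exists[OF p] k by blast
  have m1: "p ^ k > 1"
    using prime_gt_1_nat[OF p(1)] k by (intro one_less_power)
  have p2: "p > 2"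
    using p prime_ge_2_nat[of p] by (cases "p = 2") auto
  define t where "t = totient (p ^ k)"
  have "t = p ^ (k - 1) * (p - 1)"
    using p k by (simp add: t_def totient_prime_power)
  then have "even t" "t > 0"
    using p m1 p2 by (auto simp: t_def)
  then obtain h where h: "t = 2 * h" "h > 0" by (auto elim!: evenE)
  have ord: "ord (p ^ k) g = t"
    using g by (simp add: residue_primroot_def t_def)
  have "[g ^ t = 1] (mod p ^ k)"
    using ord_works[of g "p ^ k"] ord by simp
  then have "[int g ^ t = 1] (mod int (p ^ k))"
    by (metis cong_int_iff of_nat_1 of_nat_power)
  moreover have "int g ^ t - 1 = (int g ^ h - 1) * (int g ^ h + 1)"
    by (simp add: h algebra_simps mult_2_right flip: power_add)
  ultimately have dvd: "int p ^ k dvd (int g ^ h - 1) * (int g ^ h + 1)"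
    by (simp add: cong_iff_dvd_diff)
  have not: "\<not> int p ^ k dvd int g ^ h - 1"
  proof
    assume "int p ^ k dvd int g ^ h - 1"
    then have "[int (g ^ h) = int 1] (mod int (p ^ k))"
      by (simp add: cong_iff_dvd_diff)
    then have "[g ^ h = 1] (mod p ^ k)"
      by (simp only: cong_int_iff)
    then have "t dvd h"
      using ord_divides[of g h "p ^ k"] ord by simp
    then show False
      using h by (auto dest: dvd_imp_le)
  qed
  \<comment> \<open>The odd prime \<open>p\<close> cannot divide both \<open>g ^ h - 1\<close> and
    \<open>g ^ h + 1\<close>, whose difference is 2. So all of \<open>p ^ k\<close> divides one of
    them, and the order of \<open>g\<close> rules out the first.\<close>
  have gh: "int p ^ k dvd int g ^ h + 1"
  proof (cases "int p dvd int g ^ h + 1")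
    case True
    have "\<not> int p dvd int g ^ h - 1"
    proof
      assume "int p dvd int g ^ h - 1"
      from dvd_diff[OF True this] have "int p dvd int 2" by simp
      then have "p dvd 2" by (simp only: int_dvd_int_iff)
      then show False using p2 by (auto dest: dvd_imp_le)
    qed
    then have "coprime (int p ^ k) (int g ^ h - 1)"
      using p by (simp add: prime_imp_coprime)
    then show ?thesis
      using dvd by (simp add: coprime_dvd_mult_right_iff)
  next
    case False
    then have "coprime (int p ^ k) (int g ^ h + 1)"
      using p by (simp add: prime_imp_coprime)
    then show ?thesis
      using dvd not by (simp add: coprime_dvd_mult_left_iff)
  qed
  have "(\<Prod>j\<in>totatives (p ^ k). int j) = (\<Prod>i<t. int (g ^ i mod p ^ k))"
    using residue_primroot_is_generator[OF m1 g] unfolding t_def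
    by (rule prod.reindex_bij_betw[symmetric])
  also have "[\<dots> = (\<Prod>i<t. int g ^ i)] (mod int (p ^ k))"
    by (intro cong_prod) (simp add: cong_def zmod_int)
  also have "(\<Prod>i<t. int g ^ i) = int g ^ (\<Sum>i<t. i)"
    by (simp add: power_sum)
  also have "(\<Sum>i<t. i) = h * (t - 1)"
    using h by (simp add: Sum_Ico_nat lessThan_atLeast0)
  also have "int g ^ (h * (t - 1)) = (int g ^ h) ^ (t - 1)"
    by (simp add: power_mult)
  also have "[\<dots> = (-1) ^ (t - 1)] (mod int (p ^ k))"
    using gh by (intro cong_pow) (simp add: cong_iff_dvd_diff)
  also have "(-1 :: int) ^ (t - 1) = -1"
    using h by simp
  finally show ?thesis .
qed

section \<open>Unit parts and their products over windows of consecutive integers\<close>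

text \<open>Replacing multiples of \<open>p\<close> by 1 turns products restricted to
  \<open>p\<close>-free indices into products over full ranges, which shift easily. The ring is
  arbitrary because both integers and p-adic integers occur.\<close>

definition unit_part :: "'a :: comm_ring_1 \<Rightarrow> 'a \<Rightarrow> 'a" where
  "unit_part p x = (if p dvd x then 1 else x)"

lemma prod_shift_window:
  fixes f :: "nat \<Rightarrow> 'a :: comm_monoid_mult"
  shows "f n * (\<Prod>i<m. f (Suc n + i)) = (\<Prod>i<m. f (n + i)) * f (n + m)"
  using prod.lessThan_Suc_shift[of "\<lambda>i. f (n + i)" m] by simp

lemma prod_unit_part_eq:
  "(\<Prod>i<m. unit_part (int p) (int i)) = (\<Prod>j | j < m \<and> \<not> p dvd j. int j)"
proof -
  have "(\<Prod>i<m. unit_part (int p) (int i)) = (\<Prod>i\<in>{i \<in> {..<m}. \<not> p dvd i}. int i)"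
    by (subst prod.inter_filter) (auto simp: unit_part_def intro!: prod.cong)
  then show ?thesis by simp
qed

lemma coprime_unit_part:
  assumes "prime p" shows "coprime (unit_part (int p) x) (int p ^ k)"
proof -
  have "coprime (int p ^ k) (unit_part (int p) x)"
    using assms by (simp add: unit_part_def prime_imp_coprime)
  then show ?thesis by (simp only: coprime_commute)
qed

lemma unit_part_cong:
  assumes "[x = y] (mod int p ^ k)" "k > 0"
  shows "[unit_part (int p) x = unit_part (int p) y] (mod int p ^ k)"
proof -
  have "int p dvd x - y"
    using assms by (meson cong_iff_dvd_diff dvd_power dvd_trans)
  then have "int p dvd x \<longleftrightarrow> int p dvd y"
    by (metis dvd_add_right_iff diff_add_cancel)
  then show ?thesis using assms by (simp add: unit_part_def)
qed

text \<open>Moving the window by one exchanges the factor at \<open>n\<close> for the one at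
  \<open>n + p ^ k\<close>; the two are congruent and coprime to \<open>p\<close>. The window at 0
  is Wilson's product.\<close>

lemma prod_unit_part_window:
  assumes p: "prime p" "odd p" and k: "k > 0"
  shows "[(\<Prod>i<p ^ k. unit_part (int p) (int (n + i))) = -1] (mod int p ^ k)"
proof (induction n)
  case 0
  have "totatives (p ^ k) = {j. j < p ^ k \<and> \<not> p dvd j}"
  proof (rule Set.set_eqI)
    fix j
    have "coprime j (p ^ k) \<longleftrightarrow> \<not> p dvd j"
      using p k prime_imp_coprime[of p j]
      by (auto simp: coprime_commute[of j] coprime_absorb_left)
    moreover have "j < p ^ k" if "j \<le> p ^ k" "\<not> p dvd j"
      using that k by (metis dvd_power le_neq_implies_less)
    ultimately show "j \<in> totatives (p ^ k) \<longleftrightarrow> j \<in> {j. j < p ^ k \<and> \<not> p dvd j}"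
      by (auto simp: totatives_def intro!: Nat.gr0I)
  qed
  then show ?case
    using prod_totatives_odd_prime_power[OF assms] by (simp add: prod_unit_part_eq)
next
  case (Suc n)
  let ?f = "\<lambda>i. unit_part (int p) (int i)"
  have "?f n * (\<Prod>i<p ^ k. ?f (Suc n + i)) = (\<Prod>i<p ^ k. ?f (n + i)) * ?f (n + p ^ k)"
    by (rule prod_shift_window)
  also have "[\<dots> = -1 * ?f n] (mod int p ^ k)"
    by (intro cong_mult Suc.IH unit_part_cong k) (simp add: cong_iff_dvd_diff)
  finally have "[?f n * (\<Prod>i<p ^ k. ?f (Suc n + i)) = ?f n * (-1)] (mod int p ^ k)"
    by simp
  then show ?case
    using cong_mult_lcancel[OF coprime_unit_part[OF p(1)]] by blast
qed

text \<open>
  The product \<open>U n\<close> over a window of length \<open>p\<close> satisfies \<open>n * U (n + 1) = (n + p) * U n\<close> (or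
  \<open>U (n + 1) = U n\<close> if \<open>p\<close> divides \<open>n\<close>), so
  \<open>U (n + p) / U n\<close> does not depend on \<open>n\<close> modulo \<open>p\<^sup>2\<close>; at \<open>n = 0\<close> it is \<open>1\<close> because
  \<open>(p + j) * (p - j) \<equiv> j * (- j)\<close>.
\<close>

lemma prod_unit_part_shift:
  assumes p: "prime p" "odd p"
  shows "[(\<Prod>i<p. unit_part (int p) (int (n + p + i))) =
          (\<Prod>i<p. unit_part (int p) (int (n + i)))] (mod int p ^ 2)"
proof (induction n)
  case 0
  have p0: "p > 0" using p prime_gt_0_nat by auto
  have split: "(\<Prod>i<p. unit_part (int p) (int (m + i))) = (\<Prod>j\<in>{1..<p}. int (m + j))"
    if "p dvd m" for m
  proof -
    have "{..<p} = insert 0 {1..<p}" using p0 by auto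
    then have "(\<Prod>i<p. unit_part (int p) (int (m + i)))
        = (\<Prod>j\<in>{1..<p}. unit_part (int p) (int (m + j)))"
      using that by (simp add: unit_part_def)
    also have "\<dots> = (\<Prod>j\<in>{1..<p}. int (m + j))"
    proof (rule prod.cong[OF refl])
      fix j assume "j \<in> {1..<p}"
      then have "\<not> p dvd m + j"
        using that by (auto simp: dvd_add_right_iff dest: dvd_imp_le)
      then have "\<not> int p dvd int (m + j)" by (simp only: int_dvd_int_iff) simp
      then show "unit_part (int p) (int (m + j)) = int (m + j)"
        by (simp only: unit_part_def if_False)
    qed
    finally show ?thesis .
  qed
  let ?F = "\<Prod>j\<in>{1..<p}. int j"
  have rev: "?F = (\<Prod>j\<in>{1..<p}. int p - int j)"
    by (rule prod.reindex_bij_witness[of _ "\<lambda>j. p - j" "\<lambda>j. p - j"]) auto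
  have "(\<Prod>j\<in>{1..<p}. int (p + j)) * ?F
      = (\<Prod>j\<in>{1..<p}. (int p + int j) * (int p - int j))"
    by (subst rev) (simp add: prod.distrib)
  also have "[\<dots> = (\<Prod>j\<in>{1..<p}. int j * (- int j))] (mod int p ^ 2)"
    by (intro cong_prod) (simp add: cong_iff_dvd_diff algebra_simps power2_eq_square)
  also have "(\<Prod>j\<in>{1..<p}. int j * (- int j)) = ?F * (\<Prod>j\<in>{1..<p}. (-1) * int j)"
    by (subst prod.distrib[symmetric]) simp
  \<comment> \<open>There are \<open>p - 1\<close> signs, an even number.\<close>
  also have "(\<Prod>j\<in>{1..<p}. (-1) * int j) = ?F"
    using p p0 by (subst prod.distrib) simp
  finally have "[(\<Prod>j\<in>{1..<p}. int (p + j)) * ?F = ?F * ?F] (mod int p ^ 2)" .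
  moreover have "coprime ?F (int p ^ 2)"
  proof (rule prod_coprime_left)
    fix j assume j: "j \<in> {1..<p}"
    then have "\<not> p dvd j" by (auto dest: dvd_imp_le)
    then show "coprime (int j) (int p ^ 2)"
      using coprime_unit_part[OF p(1), of "int j" 2] by (simp add: unit_part_def)
  qed
  ultimately have "[(\<Prod>j\<in>{1..<p}. int (p + j)) = ?F] (mod int p ^ 2)"
    using cong_mult_rcancel by blast
  then show ?case using split[of p] split[of 0] by simp
next
  case (Suc n)
  let ?f = "\<lambda>i. unit_part (int p) (int i)"
  let ?U = "\<lambda>n. \<Prod>i<p. ?f (n + i)"
  have 1: "?f n * ?U (Suc n) = ?U n * ?f (n + p)"
    by (rule prod_shift_window)
  have 2: "?f (n + p) * ?U (Suc (n + p)) = ?U (n + p) * ?f (n + p + p)"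
    by (rule prod_shift_window)
  \<comment> \<open>\<open>n * (n + 2 * p)\<close> and \<open>(n + p) ^ 2\<close> differ by exactly
    \<open>p ^ 2\<close>; if \<open>p\<close> divides \<open>n\<close>, every factor is 1.\<close>
  have 3: "[?f n * ?f (n + p + p) = ?f (n + p) * ?f (n + p)] (mod int p ^ 2)"
  proof (cases "p dvd n")
    case False
    have "int n * (int n + 2 * int p) - (int n + int p) * (int n + int p) = - (int p ^ 2)"
      by (simp add: algebra_simps power2_eq_square)
    moreover have "\<not> p dvd n + p" "\<not> p dvd n + p + p"
      using False dvd_add_left_iff[OF dvd_refl, of p] by auto
    then have "\<not> int p dvd int (n + p)" "\<not> int p dvd int (n + p + p)"
      by (simp_all only: int_dvd_int_iff not_False_eq_True)
    ultimately show ?thesis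
      using False by (simp add: unit_part_def cong_iff_dvd_diff add.assoc)
  next
    case True
    then show ?thesis by (simp add: unit_part_def)
  qed
  have "?f n * ?f (n + p) * ?U (Suc (n + p)) = ?U (n + p) * (?f n * ?f (n + p + p))"
    using 2 by (simp only: mult_ac)
  also have "[\<dots> = ?U n * (?f (n + p) * ?f (n + p))] (mod int p ^ 2)"
    by (intro cong_mult 3 Suc.IH)
  also have "?U n * (?f (n + p) * ?f (n + p)) = ?f n * ?f (n + p) * ?U (Suc n)"
    using arg_cong[OF 1, of "\<lambda>z. ?f (n + p) * z"] by (simp only: mult_ac)
  finally have "[?f n * ?f (n + p) * ?U (Suc (n + p)) = ?f n * ?f (n + p) * ?U (Suc n)]
    (mod int p ^ 2)" .
  moreover have "coprime (?f n * ?f (n + p)) (int p ^ 2)"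
    by (simp only: coprime_mult_left_iff coprime_unit_part[OF p(1)])
  ultimately show ?case
    using cong_mult_lcancel by fastforce
qed

section \<open>Values of the p-adic Gamma function at natural numbers\<close>

text \<open>One sign per factor makes the functional equation a one-step recursion.\<close>

definition morita :: "nat \<Rightarrow> nat \<Rightarrow> int" where
  "morita p n = (\<Prod>i<n. - unit_part (int p) (int i))"

lemma morita_altdef:
  "morita p n = (- 1) ^ n * int (\<Prod>j | 1 \<le> j \<and> j < n \<and> \<not> p dvd j. j)"
proof -
  have "morita p n = (\<Prod>i<n. (-1) * unit_part (int p) (int i))"
    by (simp add: morita_def)
  also have "\<dots> = (-1) ^ n * (\<Prod>j | j < n \<and> \<not> p dvd j. int j)"
    by (simp only: prod.distrib prod_unit_part_eq) simp
  also have "{j. j < n \<and> \<not> p dvd j} = {j. 1 \<le> j \<and> j < n \<and> \<not> p dvd j}"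
    by (auto simp: Suc_le_eq intro!: Nat.gr0I)
  finally show ?thesis by simp
qed

lemma morita_Suc: "morita p (Suc n) = - unit_part (int p) (int n) * morita p n"
  by (simp add: morita_def)

lemma morita_add:
  "morita p (n + k) = morita p n * (-1) ^ k * (\<Prod>i<k. unit_part (int p) (int (n + i)))"
  by (induction k) (simp_all add: morita_Suc mult_ac)

lemma coprime_morita:
  assumes "prime p" shows "coprime (morita p n) (int p ^ k)"
  unfolding morita_def
  by (intro prod_coprime_left) (simp only: coprime_minus_left_iff coprime_unit_part assms)

text \<open>A shift by \<open>p ^ k\<close> contributes the sign \<open>(-1) ^ (p ^ k) = -1\<close>
  and a window product congruent to \<open>-1\<close>, which cancel. This is the uniform continuity
  behind the extension to the p-adic integers.\<close>

lemma morita_cong: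
  assumes p: "prime p" "odd p" and "[m = n] (mod p ^ k)"
  shows "[morita p m = morita p n] (mod int p ^ k)"
proof (cases "k = 0")
  case False
  have step: "[morita p (m + p ^ k) = morita p m] (mod int p ^ k)" for m
  proof -
    have "[morita p (m + p ^ k) = morita p m * (-1) ^ (p ^ k) * (-1)] (mod int p ^ k)"
      unfolding morita_add using False
      by (intro cong_mult cong_refl prod_unit_part_window p) auto
    then show ?thesis using p by simp
  qed
  have steps: "[morita p (m + p ^ k * q) = morita p m] (mod int p ^ k)" for m q
  proof (induction q)
    case (Suc q)
    have "[morita p (m + p ^ k * q + p ^ k) = morita p m] (mod int p ^ k)"
      by (rule cong_trans[OF step Suc.IH])
    then show ?case by (simp only: mult_Suc_right add_ac)
  qed simp
  from assms(3) obtain q1 q2 where "m + p ^ k * q1 = n + p ^ k * q2"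
    by (metis cong_iff_lin_nat mult.commute)
  then show ?thesis
    by (metis steps cong_sym cong_trans)
qed simp

text \<open>Modulo \<open>p ^ 2\<close> the window product is unchanged by shifts by
  \<open>p\<close>, so \<open>morita p (n + p * k)\<close> is geometric in \<open>k\<close> with
  ratio \<open>- ?U n\<close>, and exponents add.\<close>

lemma morita_quasi_additive:
  assumes p: "prime p" "odd p"
  shows "[morita p (n + p * s + p * t) * morita p n =
          morita p (n + p * s) * morita p (n + p * t)] (mod int p ^ 2)"
proof -
  let ?U = "\<lambda>n. \<Prod>i<p. unit_part (int p) (int (n + i))"
  have shift: "[?U (n + p * k) = ?U n] (mod int p ^ 2)" for k
  proof (induction k)
    case (Suc k)
    have "[?U (n + p * k + p) = ?U n] (mod int p ^ 2)"
      by (rule cong_trans[OF prod_unit_part_shift[OF p] Suc.IH])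
    then show ?case by (simp only: mult_Suc_right add_ac)
  qed simp
  have pow: "[morita p (n + p * k) = morita p n * (- ?U n) ^ k] (mod int p ^ 2)" for k
  proof (induction k)
    case (Suc k)
    have "morita p (n + p * k + p) = morita p (n + p * k) * - ?U (n + p * k)"
      using p by (simp add: morita_add)
    also have "[\<dots> = morita p n * (- ?U n) ^ k * - ?U n] (mod int p ^ 2)"
      by (intro cong_mult Suc.IH) (simp only: cong_minus_minus_iff shift)
    finally show ?case by (simp only: mult_Suc_right add_ac power_Suc mult_ac)
  qed simp
  have "[morita p (n + p * (s + t)) * morita p n
       = morita p n * (- ?U n) ^ (s + t) * morita p n] (mod int p ^ 2)"
    by (intro cong_mult pow cong_refl)
  also have "morita p n * (- ?U n) ^ (s + t) * morita p n
     = (morita p n * (- ?U n) ^ s) * (morita p n * (- ?U n) ^ t)"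
    by (simp only: power_add mult_ac)
  also have "[\<dots> = morita p (n + p * s) * morita p (n + p * t)] (mod int p ^ 2)"
    by (intro cong_mult pow[THEN cong_sym])
  finally show ?thesis by (simp only: distrib_left add.assoc)
qed


section \<open>The p-adic Gamma function\<close>

lemma padic_res_of_int:
  "padic_res (of_int k :: 'p :: prime_card padic_int) n = k mod int CARD('p) ^ n"
  by (cases k rule: int_cases2)
    (simp_all add: padic_res_of_nat uminus_padic_int.rep_eq mod_simps)

lemma padic_power_dvd_diff_iff:
  "of_nat CARD('p) ^ n dvd (x - y :: 'p :: prime_card padic_int) \<longleftrightarrow>
    padic_res x n = padic_res y n"
proof -
  have "of_nat CARD('p) ^ n dvd (x - y) \<longleftrightarrow>
      int CARD('p) ^ n dvd padic_res x n - padic_res y n"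
    by (simp add: padic_power_dvd_iff minus_padic_int.rep_eq dvd_eq_mod_eq_0)
  also have "\<dots> \<longleftrightarrow> padic_res x n mod int CARD('p) ^ n = padic_res y n mod int CARD('p) ^ n"
    by (simp add: mod_eq_dvd_iff)
  finally show ?thesis by (simp add: padic_res_range)
qed

lemma padic_power_dvd_of_int_iff:
  "of_nat CARD('p) ^ n dvd (of_int k :: 'p :: prime_card padic_int) \<longleftrightarrow> int CARD('p) ^ n dvd k"
  by (simp add: padic_power_dvd_iff padic_res_of_int dvd_eq_mod_eq_0)

lemma padic_dvd_of_nat_iff:
  "of_nat CARD('p) dvd (of_nat k :: 'p :: prime_card padic_int) \<longleftrightarrow> CARD('p) dvd k"
  using padic_power_dvd_of_int_iff[of 1 "int k"] by (simp add: int_dvd_int_iff[symmetric] del: int_dvd_int_iff)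

lemma padic_approx:
  "of_nat CARD('p) ^ n dvd (x - of_nat (nat (padic_res x n)) :: 'p :: prime_card padic_int)"
  by (simp add: padic_power_dvd_diff_iff padic_res_of_int padic_res_range)

text \<open>Residues modulo \<open>p ^ 0\<close> are always 0. Restricting to \<open>n > 0\<close>
  lets users of the rule draw conclusions modulo \<open>p\<close>.\<close>

lemma padic_eqI:
  fixes x y :: "'p :: prime_card padic_int"
  assumes "\<And>n. n > 0 \<Longrightarrow> of_nat CARD('p) ^ n dvd x - y"
  shows "x = y"
proof (rule padic_res_eqI)
  fix n
  show "padic_res x n = padic_res y n"
    using assms padic_res_range[of x 0] padic_res_range[of y 0]
    by (cases "n = 0") (simp_all add: padic_power_dvd_diff_iff)
qed

text \<open>The inverses modulo all \<open>p ^ n\<close> form a coherent sequence, since an inverse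
  modulo \<open>p ^ n\<close> is unique; that sequence is the p-adic inverse.\<close>

lemma padic_unitI:
  fixes x :: "'p :: prime_card padic_int"
  assumes "\<not> of_nat CARD('p) dvd x"
  shows "x dvd 1"
proof -
  let ?p = "int CARD('p)"
  define y where "y n = modular_inverse (?p ^ n) (padic_res x n)" for n
  have cop: "coprime (padic_res x n) (?p ^ n)" for n
  proof (cases "n = 0")
    case False
    have "padic_res x 1 \<noteq> 0"
      using assms padic_power_dvd_iff[of 1 x] by simp
    moreover have "padic_res x n mod ?p ^ 1 = padic_res x 1"
      using False by (intro padic_res_mod) simp
    ultimately have "\<not> ?p dvd padic_res x n"
      by (simp add: dvd_eq_mod_eq_0)
    then have "coprime ?p (padic_res x n)"
      using prime_card[where 'a = 'p] by (simp add: prime_imp_coprime)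
    then show ?thesis by (simp add: coprime_commute)
  qed simp
  have inv: "[padic_res x n * y n = 1] (mod ?p ^ n)" for n
    unfolding y_def by (rule cong_modular_inverse1[OF cop])
  have range: "0 \<le> y n" "y n < ?p ^ n" for n
    by (simp_all add: y_def prime_card_power_pos modular_inverse_int_nonneg modular_inverse_int_less)
  have "y (Suc n) mod ?p ^ n = y n" for n
  proof -
    have "[padic_res x (Suc n) * y (Suc n) = 1] (mod ?p ^ n)"
      by (rule cong_dvd_modulus[OF inv]) simp
    then have "[padic_res x (Suc n) mod ?p ^ n * (y (Suc n) mod ?p ^ n) = 1] (mod ?p ^ n)"
      by (simp add: cong_def mod_simps)
    moreover have "padic_res x (Suc n) mod ?p ^ n = padic_res x n"
      by (rule padic_res_mod) simp
    ultimately have "modular_inverse (?p ^ n) (padic_res x n) = y (Suc n) mod ?p ^ n"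
      by (intro modular_inverse_int_eqI) (simp_all add: prime_card_power_pos)
    then show ?thesis by (simp add: y_def)
  qed
  then have rep: "padic_res (Abs_padic_int y :: 'p padic_int) = y"
    by (intro Abs_padic_int_inverse) (simp add: range)
  have "x * Abs_padic_int y = 1"
    using inv by (intro padic_res_eqI)
      (simp add: times_padic_int.rep_eq one_padic_int.rep_eq rep cong_def)
  then show ?thesis by (metis dvd_triv_left)
qed

lemma padic_not_unit: "\<not> of_nat CARD('p) dvd (1 :: 'p :: prime_card padic_int)"
  using padic_dvd_of_nat_iff[of 1, where 'p = 'p] prime_gt_1_nat[OF prime_card[where 'a = 'p]]
  by simp

lemma padic_unit_iff:
  "(x :: 'p :: prime_card padic_int) dvd 1 \<longleftrightarrow> \<not> of_nat CARD('p) dvd x"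
  using padic_unitI padic_not_unit dvd_trans by blast

section \<open>Continuity and density of the natural numbers\<close>

lemma padic_dist_le_iff:
  "dist (x :: 'p :: prime_card padic_int) y \<le> 1 / real CARD('p) ^ n \<longleftrightarrow>
    of_nat CARD('p) ^ n dvd x - y"
  by (simp add: dist_padic_int_def padic_abs_le_iff)

lemma padic_small_power:
  assumes "e > 0"
  obtains n where "1 / real CARD('p :: prime_card) ^ n < e"
proof -
  have "1 / real CARD('p) < 1"
    using prime_gt_1_nat[OF prime_card[where 'a = 'p]] by simp
  then obtain n where "(1 / real CARD('p)) ^ n < e"
    using real_arch_pow_inv[OF assms] by blast
  then show ?thesis using that by (simp add: power_divide)
qed

text \<open>Preserving congruences modulo every \<open>p ^ n\<close> is being 1-Lipschitz for the
  p-adic distance.\<close>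

lemma padic_continuousI:
  fixes f :: "'p :: prime_card padic_int \<Rightarrow> 'p padic_int"
  assumes "\<And>n x y. of_nat CARD('p) ^ n dvd x - y \<Longrightarrow> of_nat CARD('p) ^ n dvd f x - f y"
  shows "continuous_on UNIV f"
  unfolding continuous_on_iff
proof (intro ballI allI impI)
  fix x :: "'p padic_int" and e :: real
  assume "e > 0"
  then obtain n where n: "1 / real CARD('p) ^ n < e"
    by (rule padic_small_power)
  show "\<exists>d>0. \<forall>y\<in>UNIV. dist y x < d \<longrightarrow> dist (f y) (f x) < e"
  proof (intro exI[of _ "1 / real CARD('p) ^ n"] conjI ballI impI)
    show "1 / real CARD('p) ^ n > 0"
      using prime_gt_0_nat[OF prime_card[where 'a = 'p]] by simp
    fix y assume "dist y x < 1 / real CARD('p) ^ n"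
    then have "dist (f y) (f x) \<le> 1 / real CARD('p) ^ n"
      using assms padic_dist_le_iff less_imp_le by blast
    then show "dist (f y) (f x) < e" using n by simp
  qed
qed

text \<open>Natural numbers are therefore dense, so a continuous function is determined by its
  values on them.\<close>

lemma padic_approx_tendsto:
  "(\<lambda>n. of_nat (nat (padic_res x n))) \<longlonglongrightarrow> (x :: 'p :: prime_card padic_int)"
proof (rule metric_LIMSEQ_I)
  fix e :: real
  assume "e > 0"
  then obtain N where N: "1 / real CARD('p) ^ N < e"
    by (rule padic_small_power)
  have "dist (of_nat (nat (padic_res x n))) x < e" if "n \<ge> N" for n
  proof -
    have "of_nat CARD('p) ^ N dvd x - of_nat (nat (padic_res x n))"
      using padic_approx[of n x] that by (metis dvd_trans le_imp_power_dvd)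
    then have "dist x (of_nat (nat (padic_res x n))) \<le> 1 / real CARD('p) ^ N"
      by (simp only: padic_dist_le_iff)
    then show ?thesis using N by (simp add: dist_commute)
  qed
  then show "\<exists>no. \<forall>n\<ge>no. dist (of_nat (nat (padic_res x n))) x < e" by blast
qed

lemma padic_continuous_eqI:
  fixes f g :: "'p :: prime_card padic_int \<Rightarrow> 'p padic_int"
  assumes "continuous_on UNIV f" "continuous_on UNIV g" "\<And>n. f (of_nat n) = g (of_nat n)"
  shows "f = g"
proof
  fix x :: "'p padic_int"
  have lim: "(\<lambda>n. h (of_nat (nat (padic_res x n)))) \<longlonglongrightarrow> h x"
    if "continuous_on UNIV h" for h :: "'p padic_int \<Rightarrow> 'p padic_int"
    by (rule continuous_on_tendsto_compose[OF that padic_approx_tendsto]) auto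
  show "f x = g x"
    using lim[OF assms(1)] lim[OF assms(2)] assms(3) by (intro LIMSEQ_unique) auto
qed

section \<open>The continuous extension of Morita's product\<close>

text \<open>The residue modulo \<open>p ^ n\<close> is read off at a natural number congruent to
  \<open>x\<close> modulo \<open>p ^ n\<close>.\<close>

definition morita_ext :: "'p :: prime_card padic_int \<Rightarrow> 'p padic_int" where
  "morita_ext x = Abs_padic_int
     (\<lambda>n. morita CARD('p) (nat (padic_res x n)) mod int CARD('p) ^ n)"

context
  assumes odd: "odd CARD('p :: prime_card)"
begin

lemma padic_res_morita_ext:
  "padic_res (morita_ext (x :: 'p padic_int)) n =
     morita CARD('p) (nat (padic_res x n)) mod int CARD('p) ^ n"
proof -
  let ?y = "\<lambda>n. morita CARD('p) (nat (padic_res x n)) mod int CARD('p) ^ n"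
  have "?y (Suc n) mod int CARD('p) ^ n = ?y n" for n
  proof -
    have "padic_res x (Suc n) mod int CARD('p) ^ n = padic_res x n mod int CARD('p) ^ n"
      by (simp add: padic_res_mod padic_res_range)
    then have "[int (nat (padic_res x (Suc n))) = int (nat (padic_res x n))]
        (mod int (CARD('p) ^ n))"
      by (simp add: cong_def padic_res_range)
    then have "[nat (padic_res x (Suc n)) = nat (padic_res x n)] (mod CARD('p) ^ n)"
      by (simp only: cong_int_iff)
    then have "[morita CARD('p) (nat (padic_res x (Suc n))) =
        morita CARD('p) (nat (padic_res x n))] (mod int CARD('p) ^ n)"
      by (rule morita_cong[OF prime_card odd])
    then show ?thesis by (simp add: mod_prime_card_power_Suc cong_def del: power_Suc)
  qed
  then have "padic_res (Abs_padic_int ?y :: 'p padic_int) = ?y"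
    by (intro Abs_padic_int_inverse) (simp add: prime_card_power_pos del: power_Suc)
  then show ?thesis by (simp add: morita_ext_def)
qed

lemma morita_ext_cong:
  assumes "of_nat CARD('p) ^ n dvd (x - y :: 'p padic_int)"
  shows "of_nat CARD('p) ^ n dvd morita_ext x - morita_ext y"
  using assms by (simp add: padic_power_dvd_diff_iff padic_res_morita_ext)

lemma morita_ext_of_nat: "morita_ext (of_nat m :: 'p padic_int) = of_int (morita CARD('p) m)"
proof (rule padic_res_eqI)
  fix n
  have "[nat (int m mod int CARD('p) ^ n) = m] (mod CARD('p) ^ n)"
    by (simp add: cong_def flip: zmod_int of_nat_power)
  from morita_cong[OF prime_card odd this]
  show "padic_res (morita_ext (of_nat m :: 'p padic_int)) n =
      padic_res (of_int (morita CARD('p) m) :: 'p padic_int) n"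
    by (simp add: padic_res_morita_ext padic_res_of_nat padic_res_of_int cong_def)
qed

text \<open>\<open>morita_ext\<close> settles existence in the definite description, and density of
  the natural numbers settles uniqueness.\<close>

lemma padic_Gamma_eq_morita_ext: "(padic_Gamma :: 'p padic_int \<Rightarrow> _) = morita_ext"
  unfolding padic_Gamma_def
proof (rule the_equality)
  show goal: "continuous_on UNIV (morita_ext :: 'p padic_int \<Rightarrow> _) \<and> (\<forall>n. morita_ext (of_nat n :: 'p padic_int) =
      (- 1) ^ n * of_nat (\<Prod>j | 1 \<le> j \<and> j < n \<and> \<not> CARD('p) dvd j. j))"
    by (auto intro!: padic_continuousI morita_ext_cong
        simp: morita_ext_of_nat morita_altdef simp del: of_nat_prod of_int_prod)
  fix f :: "'p padic_int \<Rightarrow> 'p padic_int"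
  assume "continuous_on UNIV f \<and> (\<forall>n. f (of_nat n) =
      (- 1) ^ n * of_nat (\<Prod>j | 1 \<le> j \<and> j < n \<and> \<not> CARD('p) dvd j. j))"
  with goal show "f = morita_ext"
    by (intro padic_continuous_eqI) auto
qed

lemma padic_Gamma_of_nat: "padic_Gamma (of_nat m :: 'p padic_int) = of_int (morita CARD('p) m)"
  by (simp add: padic_Gamma_eq_morita_ext morita_ext_of_nat)

lemma padic_Gamma_cong:
  assumes "of_nat CARD('p) ^ n dvd (x - y :: 'p padic_int)"
  shows "of_nat CARD('p) ^ n dvd padic_Gamma x - padic_Gamma y"
  using morita_ext_cong[OF assms] by (simp add: padic_Gamma_eq_morita_ext)

end

section \<open>Congruences and factorizations of Pochhammer symbols\<close>

lemma dvd_mult_diff: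
  fixes d :: "'a :: comm_ring_1"
  assumes "d dvd a - a'" "d dvd b - b'"
  shows "d dvd a * b - a' * b'"
proof -
  have "a * b - a' * b' = (a - a') * b + a' * (b - b')"
    by (simp add: algebra_simps)
  then show ?thesis using assms by simp
qed

lemma dvd_diff_swap: "d dvd x - y \<Longrightarrow> d dvd y - (x :: 'a :: comm_ring_1)"
  by (metis dvd_minus_iff minus_diff_eq)

lemma dvd_pochhammer_diff:
  fixes d :: "'a :: comm_ring_1"
  assumes "d dvd x - y"
  shows "d dvd pochhammer x k - pochhammer y k"
proof (induction k)
  case (Suc k)
  have "d dvd (x + of_nat k) - (y + of_nat k)" using assms by simp
  from dvd_mult_diff[OF Suc this] show ?case by (simp add: pochhammer_Suc)
qed simp

text \<open>The second product is what the p-adic Gamma function gains between \<open>x\<close> and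
  \<open>x + n\<close>, up to sign; the first collects what it omits.\<close>

lemma pochhammer_eq_unit_part:
  "pochhammer x n = (\<Prod>i\<in>{i. i < n \<and> p dvd x + of_nat i}. x + of_nat i) *
     (\<Prod>i<n. unit_part p (x + of_nat i))"
proof -
  have "(\<Prod>i\<in>{i. i < n \<and> p dvd x + of_nat i}. x + of_nat i)
      = (\<Prod>i<n. if p dvd x + of_nat i then x + of_nat i else 1)"
    using prod.inter_filter[of "{..<n}" "\<lambda>i. x + of_nat i" "\<lambda>i. p dvd x + of_nat i"] by simp
  then show ?thesis
    by (simp add: pochhammer_prod lessThan_atLeast0 flip: prod.distrib)
       (auto intro!: prod.cong simp: unit_part_def)
qed

section \<open>The ideals generated by powers of \<open>p\<close> in the p-adic integers, inside the
  field of fractions\<close>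

lemma to_fract_of_nat: "to_fract (of_nat n) = of_nat n"
  by (induction n) simp_all

lemma to_fract_pochhammer: "to_fract (pochhammer x n) = pochhammer (to_fract x) n"
  by (induction n) (simp_all add: pochhammer_Suc to_fract_of_nat)

text \<open>As sets, these let error terms be added and multiplied, with exponents adding under
  products. \<open>padic_ideal 0\<close> is the ring of p-adic integers itself.\<close>

definition padic_ideal :: "nat \<Rightarrow> 'p :: prime_card padic set" where
  "padic_ideal n = to_fract ` {x. of_nat CARD('p) ^ n dvd x}"

lemma padic_cong_iff_ideal:
  fixes x y :: "'p :: prime_card padic"
  shows "padic_cong n x y \<longleftrightarrow> x - y \<in> padic_ideal n"
proof -
  have pow: "(of_nat CARD('p) :: 'p padic) ^ n = to_fract (of_nat CARD('p) ^ n)"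
    by (induction n) (simp_all add: to_fract_of_nat)
  have "x - y = of_nat CARD('p) ^ n * to_fract z \<longleftrightarrow> x - y = to_fract (of_nat CARD('p) ^ n * z)" for z
    by (simp add: pow)
  then show ?thesis
    by (auto simp: padic_cong_def padic_ideal_def dvd_def image_iff simp del: to_fract_mult)
qed

lemma to_fract_mem_ideal_iff:
  "to_fract x \<in> padic_ideal n \<longleftrightarrow> of_nat CARD('p) ^ n dvd (x :: 'p :: prime_card padic_int)"
  by (auto simp: padic_ideal_def)

lemma padic_ideal_add: "x \<in> padic_ideal n \<Longrightarrow> y \<in> padic_ideal n \<Longrightarrow> x + y \<in> padic_ideal n"
  by (auto simp: padic_ideal_def simp flip: to_fract_add intro!: imageI)

lemma padic_ideal_diff: "x \<in> padic_ideal n \<Longrightarrow> y \<in> padic_ideal n \<Longrightarrow> x - y \<in> padic_ideal n"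
  by (auto simp: padic_ideal_def simp flip: to_fract_diff intro!: imageI)

lemma padic_ideal_mult:
  "x \<in> padic_ideal m \<Longrightarrow> y \<in> padic_ideal n \<Longrightarrow> x * y \<in> padic_ideal (m + n)"
  by (auto simp: padic_ideal_def power_add mult_dvd_mono simp flip: to_fract_mult intro!: imageI)

lemma padic_ideal_sum:
  "(\<And>i. i \<in> A \<Longrightarrow> f i \<in> padic_ideal n) \<Longrightarrow> (\<Sum>i\<in>A. f i) \<in> padic_ideal n"
  by (induction A rule: infinite_finite_induct)
     (auto intro: padic_ideal_add simp: to_fract_mem_ideal_iff[of 0, simplified])

lemma divide_unit_mem_ideal:
  fixes x u :: "'p :: prime_card padic_int"
  assumes "of_nat CARD('p) ^ n dvd x" "u dvd 1"
  shows "to_fract x / to_fract u \<in> padic_ideal n"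
proof -
  obtain v where v: "1 = u * v" using assms(2) by (auto elim: dvdE)
  then have "u \<noteq> 0" by auto
  have "to_fract u * to_fract v = 1" using v by (simp flip: to_fract_mult)
  then have "to_fract x / to_fract u = to_fract (x * v)"
    using \<open>u \<noteq> 0\<close> by (simp add: field_simps)
  then show ?thesis using assms(1) by (simp add: to_fract_mem_ideal_iff del: to_fract_mult)
qed

text \<open>Cross-multiplication reduces a congruence of quotients to divisibility in the p-adic
  integers, as the common denominator is a unit.\<close>

lemma diff_divide_unit_mem_ideal:
  fixes x y u v :: "'p :: prime_card padic_int"
  assumes "of_nat CARD('p) ^ n dvd x * v - y * u" "u dvd 1" "v dvd 1"
  shows "to_fract x / to_fract u - to_fract y / to_fract v \<in> padic_ideal n"
proof -
  have "u \<noteq> 0" "v \<noteq> 0" using assms by auto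
  then have "to_fract x / to_fract u - to_fract y / to_fract v =
      to_fract (x * v - y * u) / to_fract (u * v)"
    by (simp add: field_simps)
  also have "\<dots> \<in> padic_ideal n"
    using assms by (intro divide_unit_mem_ideal) (auto simp: is_unit_mult_iff)
  finally show ?thesis .
qed

section \<open>Least residues and the factors divisible by \<open>p\<close>\<close>

lemma padic_residue_props:
  fixes \<alpha> :: "'p :: prime_card padic_int"
  shows "padic_residue (- \<alpha>) < CARD('p)"
    and "of_nat CARD('p) dvd \<alpha> + of_nat (padic_residue (- \<alpha>))"
proof -
  have *: "padic_residue (- \<alpha>) < CARD('p) \<and>
      of_nat CARD('p) dvd (- \<alpha> - of_nat (padic_residue (- \<alpha>)))"
    unfolding padic_residue_def by (rule theI'[OF padic_residue_unique])
  then show "padic_residue (- \<alpha>) < CARD('p)" by blast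
  have "- \<alpha> - of_nat (padic_residue (- \<alpha>)) = - (\<alpha> + of_nat (padic_residue (- \<alpha>)))"
    by simp
  then show "of_nat CARD('p) dvd \<alpha> + of_nat (padic_residue (- \<alpha>))"
    using * by (metis dvd_minus_iff)
qed

text \<open>Two such indices would differ by a multiple of \<open>p\<close> while both lie below
  \<open>p\<close>. Hence a Pochhammer symbol of length at most \<open>p\<close> has at most one
  factor divisible by \<open>p\<close>.\<close>

lemma padic_dvd_shift_iff:
  fixes x :: "'p :: prime_card padic_int"
  assumes "of_nat CARD('p) dvd x + of_nat m" "m < CARD('p)" "i < CARD('p)"
  shows "of_nat CARD('p) dvd x + of_nat i \<longleftrightarrow> i = m"
proof
  assume "of_nat CARD('p) dvd x + of_nat i"
  from dvd_diff[OF this assms(1)] have "of_nat CARD('p) ^ 1 dvd (of_int (int i - int m) :: 'p padic_int)"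
    by simp
  then have "int CARD('p) dvd int i - int m"
    unfolding padic_power_dvd_of_int_iff by simp
  then show "i = m"
    using assms(2,3) by (metis mod_eq_dvd_iff mod_less of_nat_eq_iff zmod_int)
qed (use assms in simp)

section \<open>Functional equation, units and quasi-additivity of the p-adic Gamma function\<close>

context
  assumes odd: "odd CARD('p :: prime_card)"
begin

text \<open>At natural numbers this is the recursion for \<open>morita\<close>; elsewhere it is
  checked modulo each \<open>p ^ n\<close> at a natural approximation \<open>m\<close> of
  \<open>x\<close>.\<close>

lemma padic_Gamma_Suc:
  "padic_Gamma (x + 1 :: 'p padic_int) =
     - unit_part (of_nat CARD('p)) x * padic_Gamma x"
proof (rule padic_eqI)
  fix n :: nat
  assume n: "n > 0"
  let ?P = "of_nat CARD('p) :: 'p padic_int"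
  define m where "m = nat (padic_res x n)"
  have xm: "?P ^ n dvd x - of_nat m"
    unfolding m_def by (rule padic_approx)
  \<comment> \<open>Since \<open>n > 0\<close>, \<open>x\<close> and \<open>m\<close> are divisible
    by \<open>p\<close> together and fall in the same branch of \<open>unit_part\<close>.\<close>
  have "?P dvd x - of_nat m"
    using xm n by (meson dvd_power dvd_trans)
  then have "?P dvd x \<longleftrightarrow> ?P dvd of_nat m"
    by (metis dvd_add_right_iff diff_add_cancel)
  then have "?P ^ n dvd unit_part ?P x - unit_part ?P (of_nat m)"
    using xm by (simp add: unit_part_def)
  then have 1: "?P ^ n dvd (- unit_part ?P x) - (- unit_part ?P (of_nat m))"
    by (metis dvd_minus_iff minus_diff_minus)
  have "?P ^ n dvd padic_Gamma (x + 1) - padic_Gamma (of_nat m + 1)"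
    using xm by (intro padic_Gamma_cong odd) simp
  moreover have "padic_Gamma (of_nat m + 1) = - unit_part ?P (of_nat m) * padic_Gamma (of_nat m)"
  proof -
    have "unit_part ?P (of_nat m) = of_int (unit_part (int CARD('p)) (int m))"
      by (simp add: unit_part_def padic_dvd_of_nat_iff)
    moreover have "padic_Gamma (of_nat (Suc m) :: 'p padic_int) = of_int (morita CARD('p) (Suc m))"
      by (rule padic_Gamma_of_nat[OF odd])
    ultimately show ?thesis
      by (simp add: padic_Gamma_of_nat[OF odd] morita_Suc add.commute)
  qed
  ultimately have "?P ^ n dvd padic_Gamma (x + 1) - (- unit_part ?P (of_nat m) * padic_Gamma (of_nat m))"
    by simp
  moreover have "?P ^ n dvd (- unit_part ?P x) * padic_Gamma x
      - (- unit_part ?P (of_nat m)) * padic_Gamma (of_nat m)"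
    by (intro dvd_mult_diff 1 padic_Gamma_cong odd xm)
  ultimately have "?P ^ n dvd (padic_Gamma (x + 1) - (- unit_part ?P (of_nat m) * padic_Gamma (of_nat m)))
    - ((- unit_part ?P x) * padic_Gamma x - (- unit_part ?P (of_nat m)) * padic_Gamma (of_nat m))"
    by (rule dvd_diff)
  then show "?P ^ n dvd padic_Gamma (x + 1) - - unit_part ?P x * padic_Gamma x"
    by simp
qed

lemma padic_Gamma_add_of_nat:
  "padic_Gamma (x + of_nat n :: 'p padic_int) =
     (-1) ^ n * (\<Prod>i<n. unit_part (of_nat CARD('p)) (x + of_nat i)) * padic_Gamma x"
proof (induction n)
  case (Suc n)
  have "padic_Gamma (x + of_nat (Suc n)) = padic_Gamma (x + of_nat n + 1)"
    by (simp add: add_ac)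
  then show ?case by (simp add: padic_Gamma_Suc Suc mult_ac)
qed simp

lemma padic_Gamma_unit: "padic_Gamma (x :: 'p padic_int) dvd 1"
proof (rule padic_unitI)
  let ?P = "of_nat CARD('p) :: 'p padic_int"
  define m where "m = nat (padic_res x 1)"
  have "?P ^ 1 dvd x - of_nat m"
    unfolding m_def by (rule padic_approx)
  then have 1: "?P ^ 1 dvd padic_Gamma x - padic_Gamma (of_nat m)"
    by (rule padic_Gamma_cong[OF odd])
  have "\<not> int CARD('p) ^ 1 dvd morita CARD('p) m"
    using coprime_morita[OF prime_card[where 'a = 'p], of m 1] prime_card[where 'a = 'p]
    by (metis coprime_absorb_right is_unit_power_iff not_prime_unit power_one_right prime_int_iff
        prime_nat_int_transfer)
  then have "\<not> ?P ^ 1 dvd padic_Gamma (of_nat m)"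
    by (simp only: padic_Gamma_of_nat[OF odd] padic_power_dvd_of_int_iff not_False_eq_True)
  then show "\<not> ?P dvd padic_Gamma x"
    using 1 dvd_diff[of ?P "padic_Gamma x" "padic_Gamma x - padic_Gamma (of_nat m)"] by auto
qed

text \<open>Modulo \<open>p ^ 2\<close>, the arguments \<open>y\<close>, \<open>s\<close>,
  \<open>t\<close> may be replaced by natural numbers \<open>m\<close>, \<open>p * k\<close>,
  \<open>p * l\<close>, where the claim is \<open>morita_quasi_additive\<close>.\<close>

lemma padic_Gamma_quasi_additive:
  assumes "of_nat CARD('p) dvd s" "of_nat CARD('p) dvd (t :: 'p padic_int)"
  shows "of_nat CARD('p) ^ 2 dvd padic_Gamma (y + s + t) * padic_Gamma y
    - padic_Gamma (y + s) * padic_Gamma (y + t)"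
proof -
  let ?P = "of_nat CARD('p) :: 'p padic_int"
  obtain s' t' where st: "s = ?P * s'" "t = ?P * t'"
    using assms by (auto elim!: dvdE)
  define approx where "approx x = nat (padic_res x 2)" for x :: "'p padic_int"
  define m k l where "m = approx y" "k = approx s'" "l = approx t'"
  have approx: "?P ^ 2 dvd x - of_nat (approx x)" for x
    unfolding approx_def by (rule padic_approx)
  have s: "?P ^ 2 dvd s - of_nat (CARD('p) * k)" and t: "?P ^ 2 dvd t - of_nat (CARD('p) * l)"
    using approx[of s'] approx[of t'] unfolding st m_k_l_def
    by (auto simp flip: right_diff_distrib)
  have y: "?P ^ 2 dvd y - of_nat m"
    unfolding m_k_l_def by (rule approx)
  have add: "?P ^ 2 dvd (a + b) - of_nat (i + j)"
    if "?P ^ 2 dvd a - of_nat i" "?P ^ 2 dvd b - of_nat j" for a b i j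
    using dvd_add[OF that] by (simp add: algebra_simps)
  have G: "?P ^ 2 dvd padic_Gamma a - of_int (morita CARD('p) i)"
    if "?P ^ 2 dvd a - of_nat i" for a i
    using padic_Gamma_cong[OF odd that] by (simp add: padic_Gamma_of_nat[OF odd])
  let ?m = "morita CARD('p)"
  have 1: "?P ^ 2 dvd padic_Gamma (y + s + t) * padic_Gamma y -
      of_int (?m (m + CARD('p) * k + CARD('p) * l)) * of_int (?m m)"
    by (intro dvd_mult_diff G add y s t)
  have 2: "?P ^ 2 dvd padic_Gamma (y + s) * padic_Gamma (y + t) -
      of_int (?m (m + CARD('p) * k)) * of_int (?m (m + CARD('p) * l))"
    by (intro dvd_mult_diff G add y s t)
  have 3: "?P ^ 2 dvd of_int (?m (m + CARD('p) * k + CARD('p) * l) * ?m m -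
      ?m (m + CARD('p) * k) * ?m (m + CARD('p) * l))"
    using morita_quasi_additive[OF prime_card odd, of m k l]
    by (simp only: padic_power_dvd_of_int_iff cong_iff_dvd_diff)
  from dvd_add[OF dvd_diff[OF 1 2] 3] have "?P ^ 2 dvd
      (padic_Gamma (y + s + t) * padic_Gamma y -
        of_int (?m (m + CARD('p) * k + CARD('p) * l)) * of_int (?m m))
      - (padic_Gamma (y + s) * padic_Gamma (y + t) -
        of_int (?m (m + CARD('p) * k)) * of_int (?m (m + CARD('p) * l)))
      + of_int (?m (m + CARD('p) * k + CARD('p) * l) * ?m m -
        ?m (m + CARD('p) * k) * ?m (m + CARD('p) * l))"
    .
  then show ?thesis by (simp add: algebra_simps)
qed

end


section \<open>The truncated hypergeometric sum\<close>

lemma hyp2F1_trunc_commute: "hyp2F1_trunc x y z w n = hyp2F1_trunc y x z w n"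
  by (simp add: hyp2F1_trunc_def mult_ac)

text \<open>The symbol of \<open>- a\<close> vanishes beyond index \<open>a\<close>, so truncation
  at \<open>n \<ge> a\<close> loses nothing; the second hypothesis keeps the denominators
  nonzero.\<close>

lemma hyp2F1_trunc_Vandermonde:
  fixes y z :: "'a :: field_char_0"
  assumes "a \<le> n" and "\<And>i. i < a \<Longrightarrow> z \<noteq> - of_nat i"
  shows "hyp2F1_trunc (- of_nat a) y z 1 n = pochhammer (z - y) a / pochhammer z a"
proof -
  have "hyp2F1_trunc (- of_nat a) y z 1 n =
      (\<Sum>k\<in>{0..a}. pochhammer y k * pochhammer (- of_nat a) k / (of_nat (fact k) * pochhammer z k))"
    unfolding hyp2F1_trunc_def using assms(1)
    by (intro sum.mono_neutral_cong_right) (auto simp: pochhammer_of_nat_eq_0_iff mult_ac)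
  also have "\<dots> = pochhammer (z - y) a / pochhammer z a"
    using assms(2) by (intro Vandermonde_pochhammer) auto
  finally show ?thesis .
qed

text \<open>The quotient called \<open>R\<close> above: the p-adic counterpart of Gauss's evaluation
  at 1.\<close>

definition padic_Gauss :: "'p :: prime_card padic_int \<Rightarrow> 'p padic_int \<Rightarrow> 'p padic_int \<Rightarrow> 'p padic" where
  "padic_Gauss \<gamma> x y =
     to_fract (padic_Gamma \<gamma>) * to_fract (padic_Gamma (\<gamma> - x - y)) /
       (to_fract (padic_Gamma (\<gamma> - x)) * to_fract (padic_Gamma (\<gamma> - y)))"

lemma padic_Gauss_commute: "padic_Gauss \<gamma> x y = padic_Gauss \<gamma> y x"
  by (simp add: padic_Gauss_def mult_ac diff_diff_eq add.commute)

locale padic_hyp =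
  fixes \<gamma> :: "'p :: prime_card padic_int" and c :: nat
  assumes odd: "odd CARD('p)"
    and gamma: "of_nat CARD('p) dvd \<gamma> + of_nat c" and c: "c < CARD('p)"
begin

abbreviation P :: "'p padic_int" where "P \<equiv> of_nat CARD('p)"

abbreviation F :: "'p padic_int \<Rightarrow> 'p padic_int \<Rightarrow> 'p padic" where
  "F x y \<equiv> hyp2F1_trunc (to_fract x) (to_fract y) (to_fract \<gamma>) 1 c"

lemma gamma_shift_not_dvd: "i < c \<Longrightarrow> \<not> P dvd \<gamma> + of_nat i"
  using padic_dvd_shift_iff[OF gamma c, of i] c by simp

lemma gamma_shift_unit: "i < c \<Longrightarrow> \<gamma> + of_nat i dvd 1"
  using gamma_shift_not_dvd by (simp add: padic_unit_iff)

text \<open>Index \<open>c\<close> is the first at which \<open>\<gamma> + i\<close> is divisible by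
  \<open>p\<close>, and for \<open>k \<le> c\<close> the symbol stops before it. So all terms of the
  truncated sum have unit denominators.\<close>

lemma pochhammer_gamma_unit:
  assumes "k \<le> c" shows "pochhammer \<gamma> k dvd 1"
  using assms
  by (induction k) (simp_all add: pochhammer_Suc is_unit_mult_iff gamma_shift_unit)

lemma fact_unit:
  assumes "k \<le> c" shows "(fact k :: 'p padic_int) dvd 1"
proof -
  have "\<not> CARD('p) dvd fact k"
    using assms c prime_dvd_fact_iff[OF prime_card[where 'a = 'p]] by simp
  then have "\<not> P dvd of_nat (fact k)"
    by (simp only: padic_dvd_of_nat_iff not_False_eq_True)
  then show ?thesis by (simp add: padic_unit_iff)
qed

lemma hyp2F1_mixed_difference:
  assumes "P dvd x - x'" "P dvd y - y'"
  shows "F x y - F x y' - F x' y + F x' y' \<in> padic_ideal 2"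
proof -
  let ?u = "\<lambda>k. pochhammer \<gamma> k * fact k"
  let ?d = "\<lambda>x y k. pochhammer x k - pochhammer y k"
  have fact: "to_fract (fact k :: 'p padic_int) = fact k" for k
    using to_fract_of_nat[of "fact k", where 'a = "'p padic_int"] by simp
  have "F x y - F x y' - F x' y + F x' y' =
      (\<Sum>k=0..c. to_fract (?d x x' k * ?d y y' k) / to_fract (?u k))"
    supply factor = add_divide_distrib[symmetric] diff_divide_distrib[symmetric]
    unfolding hyp2F1_trunc_def sum_subtractf[symmetric] sum.distrib[symmetric]
    by (intro sum.cong refl, simp add: to_fract_pochhammer fact factor, simp add: algebra_simps)
  also have "\<dots> \<in> padic_ideal 2"
  proof (rule padic_ideal_sum, rule divide_unit_mem_ideal)
    fix k assume "k \<in> {0..c}"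
    then show "?u k dvd 1"
      using pochhammer_gamma_unit[of k] fact_unit[of k] by (simp add: is_unit_mult_iff)
    show "P ^ 2 dvd ?d x x' k * ?d y y' k"
      unfolding power2_eq_square by (intro mult_dvd_mono dvd_pochhammer_diff assms)
  qed
  finally show ?thesis .
qed

text \<open>
  If \<open>c < a + b\<close>, then \<open>\<gamma> - y + (c - b)\<close> is the only factor of \<open>pochhammer (\<gamma> - y) a\<close> divisible
  by \<open>p\<close>, and the Gamma quotient omits it.
\<close>

lemma hyp2F1_terminating:
  assumes a: "a \<le> c" and b: "b \<le> c" and y: "P dvd y + of_nat b"
  shows "F (- of_nat a) y =
    (if a + b \<le> c then 1 else to_fract (\<gamma> + of_nat c - (y + of_nat b))) *
      padic_Gauss \<gamma> (- of_nat a) y"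
proof -
  let ?G = "padic_Gamma :: 'p padic_int \<Rightarrow> _"
  let ?D = "\<lambda>x. \<Prod>i\<in>{i. i < a \<and> P dvd x + of_nat i}. x + of_nat i"
  \<comment> \<open>The Pochhammer symbol is a Gamma quotient up to \<open>?D x\<close>, here
    cleared of denominators. The sign cancels when this is applied at both \<open>\<gamma>\<close>
    and \<open>\<gamma> - y\<close>.\<close>
  have poch: "pochhammer x a * ?G x = (-1) ^ a * ?D x * ?G (x + of_nat a)" for x
    by (simp add: pochhammer_eq_unit_part[of x a P] padic_Gamma_add_of_nat[OF odd] mult_ac
        flip: power_add mult_2)
  have G0: "?G x \<noteq> 0" for x
    using padic_Gamma_unit[OF odd, of x] by auto
  have "?D \<gamma> = 1"
    using gamma_shift_not_dvd a by (intro prod.neutral) auto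
  then have poch_gamma: "pochhammer \<gamma> a * ?G \<gamma> = (-1) ^ a * ?G (\<gamma> + of_nat a)"
    using poch[of \<gamma>] by (simp only: mult_1_right)
  have "P dvd (\<gamma> + of_nat c) - (y + of_nat b)"
    using gamma y by (rule dvd_diff)
  then have dvd: "P dvd (\<gamma> - y) + of_nat (c - b)"
    using b by (simp add: of_nat_diff algebra_simps)
  \<comment> \<open>The only candidate index \<open>c - b\<close> lies below \<open>a\<close>
    exactly when \<open>a + b > c\<close>; this separates the two cases of the theorem.\<close>
  have "{i. i < a \<and> P dvd (\<gamma> - y) + of_nat i} = (if a + b \<le> c then {} else {c - b})"
    using padic_dvd_shift_iff[OF dvd] dvd a b c by (auto split: if_splits)
  then have D: "?D (\<gamma> - y) = (if a + b \<le> c then 1 else \<gamma> + of_nat c - (y + of_nat b))"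
    using b by (simp add: of_nat_diff algebra_simps)
  have poch0: "pochhammer \<gamma> a \<noteq> 0"
    using pochhammer_gamma_unit[OF a] by auto
  have "pochhammer (\<gamma> - y) a * (?G (\<gamma> + of_nat a) * ?G (\<gamma> - y)) =
      ((-1) ^ a * ?G (\<gamma> + of_nat a)) * (?D (\<gamma> - y) * ?G (\<gamma> - y + of_nat a))"
    using poch[of "\<gamma> - y"] by (simp add: mult_ac)
  also have "\<dots> = ?D (\<gamma> - y) * (?G \<gamma> * ?G (\<gamma> + of_nat a - y)) * pochhammer \<gamma> a"
    by (simp flip: poch_gamma) (simp add: mult_ac algebra_simps)
  finally have eq: "to_fract (pochhammer (\<gamma> - y) a * (?G (\<gamma> + of_nat a) * ?G (\<gamma> - y))) =
      to_fract (?D (\<gamma> - y) * (?G \<gamma> * ?G (\<gamma> + of_nat a - y)) * pochhammer \<gamma> a)"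
    by (rule arg_cong)
  have "to_fract \<gamma> \<noteq> - of_nat i" if "i < a" for i
  proof
    assume "to_fract \<gamma> = - of_nat i"
    then have "to_fract (\<gamma> + of_nat i) = 0" by (simp add: to_fract_of_nat)
    then have "\<gamma> + of_nat i = 0" by (simp only: to_fract_eq_0_iff)
    then show False using gamma_shift_not_dvd[of i] that a by simp
  qed
  then have "F (- of_nat a) y = to_fract (pochhammer (\<gamma> - y) a) / to_fract (pochhammer \<gamma> a)"
    using hyp2F1_trunc_Vandermonde[OF a, of "to_fract \<gamma>" "to_fract y"]
    by (simp add: to_fract_of_nat to_fract_pochhammer)
  also have "\<dots> = to_fract (?D (\<gamma> - y)) * padic_Gauss \<gamma> (- of_nat a) y"
    using eq G0 poch0 by (simp add: padic_Gauss_def field_simps)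
  finally show ?thesis by (simp add: D)
qed

section \<open>Congruences for the Gauss quotient and the final comparison\<close>

lemma Gauss_cong:
  assumes "P dvd x - x'" "P dvd y - y'"
  shows "padic_Gauss \<gamma> x y - padic_Gauss \<gamma> x' y' \<in> padic_ideal 1"
proof -
  let ?G = "padic_Gamma :: 'p padic_int \<Rightarrow> _"
  have G: "P dvd ?G u - ?G v" if "P dvd u - v" for u v
    using padic_Gamma_cong[OF odd, of 1 u v] that by simp
  have xx: "P dvd x' - x" "P dvd y' - y"
    by (rule assms[THEN dvd_diff_swap])+
  have 1: "P dvd (\<gamma> - x) - (\<gamma> - x')" "P dvd (\<gamma> - y) - (\<gamma> - y')"
    "P dvd (\<gamma> - x') - (\<gamma> - x)" "P dvd (\<gamma> - y') - (\<gamma> - y)"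
    using assms xx by simp_all
  have "P dvd (x' - x) + (y' - y)"
    using xx by (rule dvd_add)
  then have 2: "P dvd (\<gamma> - x - y) - (\<gamma> - x' - y')"
    by (simp add: algebra_simps)
  have "P ^ 1 dvd (?G \<gamma> * ?G (\<gamma> - x - y)) * (?G (\<gamma> - x') * ?G (\<gamma> - y'))
      - (?G \<gamma> * ?G (\<gamma> - x' - y')) * (?G (\<gamma> - x) * ?G (\<gamma> - y))"
    unfolding power_one_right by (intro dvd_mult_diff G 1 2) simp
  from diff_divide_unit_mem_ideal[OF this] show ?thesis
    by (simp add: padic_Gauss_def is_unit_mult_iff padic_Gamma_unit[OF odd])
qed

text \<open>Write \<open>A, B, C, D\<close> for the four values. Then
  \<open>A - B - C + D = (A - B * C / D) + (B - D) * (C - D) / D\<close>: quasi-additivity makes the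
  first summand vanish modulo \<open>p ^ 2\<close>, and \<open>Gauss_cong\<close> gives a factor
  \<open>p\<close> in each difference of the second.\<close>

lemma Gauss_mixed_difference:
  assumes "P dvd x - x'" "P dvd y - y'"
  shows "padic_Gauss \<gamma> x y - padic_Gauss \<gamma> x y' - padic_Gauss \<gamma> x' y + padic_Gauss \<gamma> x' y'
    \<in> padic_ideal 2"
proof -
  let ?G = "padic_Gamma :: 'p padic_int \<Rightarrow> _"
  let ?R = "padic_Gauss \<gamma>"
  have unit: "?G u dvd 1" for u by (rule padic_Gamma_unit[OF odd])
  then have G0: "?G u \<noteq> 0" for u by (metis dvd_0_left_iff zero_neq_one)
  then have R0: "?R x' y' \<noteq> 0" by (simp add: padic_Gauss_def)
  let ?H = "?G (\<gamma> - x) * ?G (\<gamma> - y)"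
  have "P dvd x' - x" "P dvd y' - y"
    by (rule assms[THEN dvd_diff_swap])+
  \<comment> \<open>The increments are \<open>x' - x\<close> and \<open>y' - y\<close>, so the four
    arguments are the values of \<open>\<gamma> - x - y\<close> at the corners.\<close>
  from padic_Gamma_quasi_additive[OF odd this, of "\<gamma> - x' - y'"]
  have add: "P ^ 2 dvd ?G (\<gamma> - x - y) * ?G (\<gamma> - x' - y') - ?G (\<gamma> - x - y') * ?G (\<gamma> - x' - y)"
    by (simp add: algebra_simps)
  have "?R x y - ?R x y' * ?R x' y / ?R x' y' =
      to_fract (?G \<gamma> * ?G (\<gamma> - x - y)) / to_fract ?H
      - to_fract (?G \<gamma> * (?G (\<gamma> - x - y') * ?G (\<gamma> - x' - y))) / to_fract (?H * ?G (\<gamma> - x' - y'))"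
    using G0 by (simp add: padic_Gauss_def field_simps)
  also have "\<dots> \<in> padic_ideal 2"
  proof (rule diff_divide_unit_mem_ideal)
    have "(?G \<gamma> * ?G (\<gamma> - x - y)) * (?H * ?G (\<gamma> - x' - y'))
        - (?G \<gamma> * (?G (\<gamma> - x - y') * ?G (\<gamma> - x' - y))) * ?H
        = (?G \<gamma> * ?H) *
          (?G (\<gamma> - x - y) * ?G (\<gamma> - x' - y') - ?G (\<gamma> - x - y') * ?G (\<gamma> - x' - y))"
      by (simp only: right_diff_distrib mult_ac)
    then show "P ^ 2 dvd (?G \<gamma> * ?G (\<gamma> - x - y)) * (?H * ?G (\<gamma> - x' - y'))
        - (?G \<gamma> * (?G (\<gamma> - x - y') * ?G (\<gamma> - x' - y))) * ?H"
      using add by simp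
  qed (simp_all add: is_unit_mult_iff unit)
  finally have 1: "?R x y - ?R x y' * ?R x' y / ?R x' y' \<in> padic_ideal 2" .
  have "to_fract (?G (\<gamma> - x') * ?G (\<gamma> - y')) / to_fract (?G \<gamma> * ?G (\<gamma> - x' - y')) \<in> padic_ideal 0"
    by (intro divide_unit_mem_ideal) (simp_all add: is_unit_mult_iff unit)
  also have "to_fract (?G (\<gamma> - x') * ?G (\<gamma> - y')) / to_fract (?G \<gamma> * ?G (\<gamma> - x' - y'))
      = 1 / ?R x' y'"
    by (simp add: padic_Gauss_def)
  finally have inv: "1 / ?R x' y' \<in> padic_ideal 0" .
  have "(?R x y' - ?R x' y') * (?R x' y - ?R x' y') * (1 / ?R x' y') \<in> padic_ideal (1 + 1 + 0)"
    using assms by (intro padic_ideal_mult Gauss_cong inv) simp_all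
  then have "(?R x y' - ?R x' y') * (?R x' y - ?R x' y') * (1 / ?R x' y') \<in> padic_ideal 2"
    by (simp add: numeral_2_eq_2)
  from padic_ideal_add[OF 1 this]
  have "?R x y - ?R x y' * ?R x' y / ?R x' y' +
      (?R x y' - ?R x' y') * (?R x' y - ?R x' y') * (1 / ?R x' y') \<in> padic_ideal 2" .
  also have "?R x y - ?R x y' * ?R x' y / ?R x' y' +
      (?R x y' - ?R x' y') * (?R x' y - ?R x' y') * (1 / ?R x' y')
      = ?R x y - ?R x y' - ?R x' y + ?R x' y'"
    using R0 by (simp add: field_simps)
  finally show ?thesis .
qed

text \<open>If \<open>a + b \<le> c\<close>, the three terminating sums equal their Gauss quotients
  and the two mixed differences are subtracted. Otherwise their coefficients \<open>s - t\<close>,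
  \<open>s - u\<close>, \<open>s\<close> are divisible by \<open>p\<close>, so knowing the quotients
  modulo \<open>p\<close> suffices.\<close>

lemma hyp2F1_cong:
  assumes a: "a \<le> c" "P dvd x + of_nat a" and b: "b \<le> c" "P dvd y + of_nat b"
  shows "padic_cong 2 (F x y)
    ((if a + b \<le> c then 1 else to_fract (\<gamma> + of_nat c - (x + of_nat a) - (y + of_nat b))) *
      padic_Gauss \<gamma> x y)"
proof -
  let ?x = "- of_nat a :: 'p padic_int" and ?y = "- of_nat b :: 'p padic_int"
  let ?R = "padic_Gauss \<gamma>"
  have xy: "P dvd x - ?x" "P dvd y - ?y" using a b by simp_all
  define s t u where "s = to_fract (\<gamma> + of_nat c)" "t = to_fract (x + of_nat a)"
    "u = to_fract (y + of_nat b)"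
  have mem: "s \<in> padic_ideal 1" "t \<in> padic_ideal 1" "u \<in> padic_ideal 1"
    using gamma a b by (simp_all add: s_t_u_def to_fract_mem_ideal_iff del: to_fract_add)
  \<comment> \<open>Replacing \<open>x\<close> by \<open>- a\<close> makes \<open>x + a\<close>
    vanish, which removes \<open>t\<close>; likewise \<open>- b\<close> removes
    \<open>u\<close>.\<close>
  have F: "F ?x y = (if a + b \<le> c then 1 else s - u) * ?R ?x y"
      "F x ?y = (if a + b \<le> c then 1 else s - t) * ?R x ?y"
      "F ?x ?y = (if a + b \<le> c then 1 else s) * ?R ?x ?y"
    using hyp2F1_terminating[OF a(1) b] hyp2F1_terminating[OF b(1) a]
      hyp2F1_terminating[OF a(1) b(1), of ?y]
    by (simp_all add: s_t_u_def add.commute[of b] hyp2F1_trunc_commute[of _ "- to_fract (of_nat b)"]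
        padic_Gauss_commute[of _ "- of_nat b"])
  have main: "F x y - F x ?y - F ?x y + F ?x ?y \<in> padic_ideal 2"
    by (rule hyp2F1_mixed_difference[OF xy])
  show ?thesis
  proof (cases "a + b \<le> c")
    case True
    from padic_ideal_diff[OF main[unfolded F] Gauss_mixed_difference[OF xy]]
    show ?thesis using True by (simp add: padic_cong_iff_ideal)
  next
    case False
    have yx: "P dvd ?x - x" "P dvd ?y - y"
      by (rule xy[THEN dvd_diff_swap])+
    have diffs: "?R x ?y - ?R x y \<in> padic_ideal 1" "?R ?x y - ?R x y \<in> padic_ideal 1"
      "?R ?x ?y - ?R x y \<in> padic_ideal 1"
      by (intro Gauss_cong yx | simp)+
    \<comment> \<open>Each quotient is exchanged for \<open>?R x y\<close> at a cost of
      \<open>p * p\<close>, and the coefficients combine as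
      \<open>(s - t) + (s - u) - s = s - t - u\<close>.\<close>
    have "(s - t) * (?R x ?y - ?R x y) + (s - u) * (?R ?x y - ?R x y) - s * (?R ?x ?y - ?R x y)
        \<in> padic_ideal (1 + 1)"
      by (rule padic_ideal_diff[OF padic_ideal_add[OF
            padic_ideal_mult[OF padic_ideal_diff[OF mem(1,2)] diffs(1)]
            padic_ideal_mult[OF padic_ideal_diff[OF mem(1,3)] diffs(2)]]
            padic_ideal_mult[OF mem(1) diffs(3)]])
    then have "(s - t) * (?R x ?y - ?R x y) + (s - u) * (?R ?x y - ?R x y)
        - s * (?R ?x ?y - ?R x y) \<in> padic_ideal 2"
      by (simp add: numeral_2_eq_2)
    from padic_ideal_add[OF main[unfolded F] this] have "F x y - (s - t - u) * ?R x y \<in> padic_ideal 2"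
      using False by (simp add: algebra_simps)
    then show ?thesis
      using False by (simp add: padic_cong_iff_ideal s_t_u_def)
  qed
qed

end

theorem theorem4p1:
  fixes \<alpha> \<beta> \<gamma> :: "'p :: prime_card padic_int"
  assumes "odd CARD('p)"
    and "\<gamma> dvd 1"
    and "padic_residue (- \<alpha>) \<le> padic_residue (- \<gamma>)"
    and "padic_residue (- \<beta>) \<le> padic_residue (- \<gamma>)"
  shows
    "(padic_residue (- \<alpha>) + padic_residue (- \<beta>) \<le> padic_residue (- \<gamma>) \<longrightarrow>
        padic_cong 2
          (hyp2F1_trunc (to_fract \<alpha>) (to_fract \<beta>) (to_fract \<gamma>) 1 (padic_residue (- \<gamma>)))
          (to_fract (padic_Gamma \<gamma>) * to_fract (padic_Gamma (\<gamma> - \<alpha> - \<beta>)) /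
             (to_fract (padic_Gamma (\<gamma> - \<alpha>)) * to_fract (padic_Gamma (\<gamma> - \<beta>))))) \<and>
     (padic_residue (- \<alpha>) + padic_residue (- \<beta>) > padic_residue (- \<gamma>) \<longrightarrow>
        padic_cong 2
          (hyp2F1_trunc (to_fract \<alpha>) (to_fract \<beta>) (to_fract \<gamma>) 1 (padic_residue (- \<gamma>)))
          (to_fract (\<gamma> + of_nat (padic_residue (- \<gamma>)) - \<alpha> - of_nat (padic_residue (- \<alpha>))
               - \<beta> - of_nat (padic_residue (- \<beta>))) *
           (to_fract (padic_Gamma \<gamma>) * to_fract (padic_Gamma (\<gamma> - \<alpha> - \<beta>)) /
             (to_fract (padic_Gamma (\<gamma> - \<alpha>)) * to_fract (padic_Gamma (\<gamma> - \<beta>))))))"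
proof -
  interpret padic_hyp \<gamma> "padic_residue (- \<gamma>)"
    by unfold_locales (rule assms(1) padic_residue_props)+
  from hyp2F1_cong[OF assms(3) padic_residue_props(2) assms(4) padic_residue_props(2)]
  show ?thesis
    by (simp add: padic_Gauss_def diff_diff_eq add.assoc split: if_splits)
qed

end
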